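(* Let $n_1,n_2,n_3,n_4\in\mathbb C\setminus\{0\}$ satisfy $\frac1{n_1}+\frac1{n_2}+\frac1{n_3}+\frac1{n_4}=2$, let $\alpha_0,\dots,\alpha_4\in\mathbb C$, and assume $\delta\neq0$. The system $(E)$ (see context) is invariant under the following transformations, written with $( * )=(x,y,t;n_1,n_2,n_3,n_4;\alpha_0,\alpha_1,\alpha_2,\alpha_3,\alpha_4)$ and $\kappa=2n_1n_2n_3-n_1n_2-n_1n_3-n_2n_3$: $$\begin{aligned} s:( * )\to&\Big(x+\frac{\alpha_2}{y},\,y,\,t;\,n_1,n_2,n_3,n_4;\,\alpha_0+\alpha_2-n_3\alpha_2,\ \frac{\kappa\alpha_1+(n_1n_2n_3-n_1n_2-n_1n_3-n_2n_3)\alpha_2}{\kappa},\\&\quad-\alpha_2,\ \alpha_3+\alpha_2-n_2\alpha_2,\ \alpha_4+\alpha_2-n_1\alpha_2\Big),\\ \pi_1:( * )\to&\big(1-x,-y,1-t;\,n_2,n_1,n_3,n_4;\,\alpha_0,\alpha_1,\alpha_2,\alpha_4,\alpha_3\big),\\ \pi_2:( * )\to&\Big(\frac{t-x}{t-1},-(t-1)y,\frac{t}{t-1};\,n_3,n_2,n_1,n_4;\,\alpha_4,\alpha_1,\alpha_2,\alpha_3,\alpha_0\Big),\\ \pi_3:( * )\to&\Big(\frac1x,-(yx+\alpha_2)x,\frac1t;\,n_4,n_2,n_3,n_1;\,\alpha_0,\ \frac{\alpha_4n_2n_3n_4}{n_1\kappa},\ \alpha_2,\ \alpha_3,\ \frac{\alpha_1\kappa}{n_1n_2n_3}\Big).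 \end{aligned}$$
   Context: With $\kappa=2n_1n_2n_3-n_1n_2-n_1n_3-n_2n_3$ and $\delta=n_1n_2\alpha_0+\kappa\alpha_1-n_1n_2n_3\alpha_2+n_1n_3\alpha_3+n_2n_3\alpha_4$, the system $(E)$ is $$\begin{aligned}\delta t(t-1)\frac{dx}{dt}=&\,n_1n_2n_3\,x(x-1)(t-x)y+\{\kappa\alpha_1-n_1n_2n_3\alpha_2\}x^2\\&+\{-\kappa\alpha_1+n_1n_2n_3\alpha_2+n_1n_3\alpha_3(t-1)+n_2n_3\alpha_4t\}x-n_2n_3\alpha_4t,\\ \delta t(t-1)\frac{dy}{dt}=&\,[(n_1n_2+n_2n_3+n_1n_3)x^2-\{n_1n_2+n_2n_3+(n_1+n_2)n_3t\}x+n_2n_3t]y^2\\&+[-\{2\kappa\alpha_1+(n_1n_2n_3-2n_1n_2-2n_1n_3-2n_2n_3)\alpha_2\}x+\kappa\alpha_1\\&\quad+\{(n_1n_2-n_1-n_2)n_3t-n_1n_2-n_2n_3\}\alpha_2-n_1n_3\alpha_3(t-1)-n_2n_3\alpha_4t]y\\&-\alpha_2[\kappa\alpha_1+(n_1n_2n_3-n_1n_2-n_1n_3-n_2n_3)\alpha_2].\end{aligned}$$ Invariance under a transformation $(x,y,t;n;\alpha)\mapsto(\tilde x,\tilde y,\tilde t;\tilde n;\tilde\alpha)$ means: substituting the birational change of variables, the system $(E)$ for $(x,y,t)$ with parameters $(n;\alpha)$ becomes the system $(E)$ for $(\tilde x,\tilde y)$ with independent variable $\tilde t$ and parameters $(\tilde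 n;\tilde\alpha)$ (wherever the rational expressions are defined). In each image, the first group (before the first semicolon) lists the new $(x,y,t)$, the second group the new $(n_1,n_2,n_3,n_4)$ and the third group the new $(\alpha_0,\alpha_1,\alpha_2,\alpha_3,\alpha_4)$, in this order; $\kappa$ is always formed from the original $n_1,n_2,n_3$.
   Formalization: In π₃ the printed new α₁ and α₄ are false (e.g. n=(1,1,2,−2), α=(0,1,0,1,0)); they are replaced by α₄n₁n₂n₃/(n₄κ) (=α₄) and α₁κn₄/(n₁n₂n₃) (=α₁). *)

theory Defs
  imports "HOL-Analysis.Analysis"
begin

type_synonym vars = "complex \<times> complex \<times> complex"
  \<comment> \<open>(x, y, t)\<close>
type_synonym ns = "complex \<times> complex \<times> complex \<times> complex"
  \<comment> \<open>(n1, n2, n3, n4)\<close>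
type_synonym alphas = "complex \<times> complex \<times> complex \<times> complex \<times> complex"
  \<comment> \<open>(a0, a1, a2, a3, a4)\<close>
type_synonym state = "vars \<times> ns \<times> alphas"

fun kappa :: "ns \<Rightarrow> complex" where
  "kappa (n1, n2, n3, n4) = 2*n1*n2*n3 - n1*n2 - n1*n3 - n2*n3"

fun delta :: "ns \<Rightarrow> alphas \<Rightarrow> complex" where
  "delta (n1, n2, n3, n4) (a0, a1, a2, a3, a4) =
     n1*n2*a0 + kappa (n1, n2, n3, n4) * a1 - n1*n2*n3*a2 + n1*n3*a3 + n2*n3*a4"

fun admissible :: "ns \<Rightarrow> alphas \<Rightarrow> bool" where
  "admissible (n1, n2, n3, n4) \<alpha> \<longleftrightarrow>
     n1 \<noteq> 0 \<and> n2 \<noteq> 0 \<and> n3 \<noteq> 0 \<and> n4 \<noteq> 0 \<and>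
     1/n1 + 1/n2 + 1/n3 + 1/n4 = 2 \<and>
     delta (n1, n2, n3, n4) \<alpha> \<noteq> 0"

fun rhs_x :: "ns \<Rightarrow> alphas \<Rightarrow> vars \<Rightarrow> complex" where
  "rhs_x (n1, n2, n3, n4) (a0, a1, a2, a3, a4) (x, y, t) =
     (let \<kappa> = kappa (n1, n2, n3, n4) in
       n1*n2*n3 * x * (x - 1) * (t - x) * y
       + (\<kappa>*a1 - n1*n2*n3*a2) * x^2
       + (- \<kappa>*a1 + n1*n2*n3*a2 + n1*n3*a3*(t - 1) + n2*n3*a4*t) * x
       - n2*n3*a4*t)"

fun rhs_y :: "ns \<Rightarrow> alphas \<Rightarrow> vars \<Rightarrow> complex" where
  "rhs_y (n1, n2, n3, n4) (a0, a1, a2, a3, a4) (x, y, t) =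
     (let \<kappa> = kappa (n1, n2, n3, n4) in
       ((n1*n2 + n2*n3 + n1*n3) * x^2
        - (n1*n2 + n2*n3 + (n1 + n2)*n3*t) * x + n2*n3*t) * y^2
       + (- (2*\<kappa>*a1 + (n1*n2*n3 - 2*n1*n2 - 2*n1*n3 - 2*n2*n3)*a2) * x
          + \<kappa>*a1 + ((n1*n2 - n1 - n2)*n3*t - n1*n2 - n2*n3)*a2
          - n1*n3*a3*(t - 1) - n2*n3*a4*t) * y
       - a2 * (\<kappa>*a1 + (n1*n2*n3 - n1*n2 - n1*n3 - n2*n3)*a2))"

definition solves_E ::
  "ns \<Rightarrow> alphas \<Rightarrow> complex set \<Rightarrow> (complex \<Rightarrow> complex) \<Rightarrow> (complex \<Rightarrow> complex) \<Rightarrow> bool" where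
  "solves_E n \<alpha> U x y \<longleftrightarrow>
     (\<forall>t\<in>U. x field_differentiable at t \<and> y field_differentiable at t \<and>
        delta n \<alpha> * t * (t - 1) * deriv x t = rhs_x n \<alpha> (x t, y t, t) \<and>
        delta n \<alpha> * t * (t - 1) * deriv y t = rhs_y n \<alpha> (x t, y t, t))"

text \<open>
  Invariance of the system with parameters \<open>(n, \<alpha>)\<close> under a transformation \<open>T\<close> whose rational
  expressions are defined on \<open>D\<close>:
  the new parameters \<open>(n', \<alpha>')\<close> do not depend on the variables and are again admissible;
  the new independent variable \<open>\<phi> t\<close> is an invertible function of \<open>t\<close> alone;
  the change of variables is invertible on \<open>D\<close>;
  and whenever \<open>(x, y)\<close>, as functions of \<open>t \<in> U\<close>, and \<open>(X, Y)\<close>, as functions of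
  \<open>\<phi> t \<in> \<phi> ` U\<close>, correspond under \<open>T\<close>, one pair solves the old system iff the other
  solves the new one.
\<close>

definition E_invariant_under :: "state set \<Rightarrow> (state \<Rightarrow> state) \<Rightarrow> ns \<Rightarrow> alphas \<Rightarrow> bool" where
  "E_invariant_under D T n \<alpha> \<longleftrightarrow>
     (\<exists>n' \<alpha>' \<phi>.
        admissible n' \<alpha>' \<and>
        (\<forall>x y t. ((x, y, t), n, \<alpha>) \<in> D \<longrightarrow>
           (\<exists>X Y. T ((x, y, t), n, \<alpha>) = ((X, Y, \<phi> t), n', \<alpha>'))) \<and>
        inj_on \<phi> {t. \<exists>x y. ((x, y, t), n, \<alpha>) \<in> D} \<and>
        inj_on (\<lambda>v. fst (T (v, n, \<alpha>))) {v. (v, n, \<alpha>) \<in> D} \<and>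
        (\<forall>U x y X Y.
           open U \<and>
           (\<forall>t\<in>U. ((x t, y t, t), n, \<alpha>) \<in> D \<and>
              T ((x t, y t, t), n, \<alpha>) = ((X (\<phi> t), Y (\<phi> t), \<phi> t), n', \<alpha>')) \<longrightarrow>
           (solves_E n \<alpha> U x y \<longleftrightarrow> solves_E n' \<alpha>' (\<phi> ` U) X Y)))"

fun s_map :: "state \<Rightarrow> state" where
  "s_map ((x, y, t), (n1, n2, n3, n4), (a0, a1, a2, a3, a4)) =
     (let \<kappa> = kappa (n1, n2, n3, n4) in
       ((x + a2/y, y, t),
        (n1, n2, n3, n4),
        (a0 + a2 - n3*a2,
         (\<kappa>*a1 + (n1*n2*n3 - n1*n2 - n1*n3 - n2*n3)*a2) / \<kappa>,
         - a2,
         a3 + a2 - n2*a2,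
         a4 + a2 - n1*a2)))"

definition s_dom :: "state set" where
  "s_dom = {((x, y, t), n, \<alpha>) | x y t n \<alpha>. y \<noteq> 0}"

fun pi1_map :: "state \<Rightarrow> state" where
  "pi1_map ((x, y, t), (n1, n2, n3, n4), (a0, a1, a2, a3, a4)) =
     ((1 - x, - y, 1 - t),
      (n2, n1, n3, n4),
      (a0, a1, a2, a4, a3))"

fun pi2_map :: "state \<Rightarrow> state" where
  "pi2_map ((x, y, t), (n1, n2, n3, n4), (a0, a1, a2, a3, a4)) =
     (((t - x)/(t - 1), - (t - 1)*y, t/(t - 1)),
      (n3, n2, n1, n4),
      (a4, a1, a2, a3, a0))"

definition pi2_dom :: "state set" where
  "pi2_dom = {((x, y, t), n, \<alpha>) | x y t n \<alpha>. t \<noteq> 1}"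

text \<open>
  The second and the last new \<open>\<alpha>\<close>-parameters below are corrected. The printed ones are
  \<open>a4*n2*n3*n4 / (n1*\<kappa>)\<close> and \<open>a1*\<kappa> / (n1*n2*n3)\<close>, for which invariance fails (already for
  \<open>n = (1, 1, 2, -2)\<close>, \<open>\<alpha> = (0, 1, 0, 1, 0)\<close>): in the first, \<open>n1\<close> and \<open>n4\<close> have to be
  exchanged, and the second lacks a factor \<open>n4\<close>. As \<open>n4*\<kappa> = n1*n2*n3\<close>, the corrected values
  are just \<open>a4\<close> and \<open>a1\<close>.
\<close>

fun pi3_map :: "state \<Rightarrow> state" where
  "pi3_map ((x, y, t), (n1, n2, n3, n4), (a0, a1, a2, a3, a4)) =
     (let \<kappa> = kappa (n1, n2, n3, n4) in
       ((1/x, - (y*x + a2)*x, 1/t),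
        (n4, n2, n3, n1),
        (a0,
         a4*n1*n2*n3 / (n4*\<kappa>),
         a2,
         a3,
         a1*\<kappa>*n4 / (n1*n2*n3))))"

definition pi3_dom :: "state set" where
  "pi3_dom = {((x, y, t), n, \<alpha>) | x y t n \<alpha>. x \<noteq> 0 \<and> t \<noteq> 0}"

end

theory Submission
  imports Defs
begin

text \<open>
  Dividing the equations by \<open>n\<^sub>1n\<^sub>2n\<^sub>3\<close> reveals the symmetry. The relation \<open>\<Sum> 1/n\<^sub>i = 2\<close> says
  precisely that \<open>\<kappa> = n\<^sub>1n\<^sub>2n\<^sub>3/n\<^sub>4\<close>, so with \<open>m\<^sub>i = 1/n\<^sub>i\<close> and
  \<open>b\<^sub>0 = \<alpha>\<^sub>0/n\<^sub>3\<close>, \<open>b\<^sub>1 = \<alpha>\<^sub>1/n\<^sub>4\<close>, \<open>b\<^sub>3 = \<alpha>\<^sub>3/n\<^sub>2\<close>, \<open>b\<^sub>4 = \<alpha>\<^sub>4/n\<^sub>1\<close>, \<open>c = \<alpha>\<^sub>2\<close>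
  the system becomes polynomial in all its data, and its left-hand coefficient becomes
  \<open>b\<^sub>0 + b\<^sub>1 + b\<^sub>3 + b\<^sub>4 - c\<close> (\<open>solves_E_iff_normal\<close>). Each \<open>b\<close> is now attached to one \<open>m\<close>, and the
  four points \<open>x = t, \<infinity>, 1, 0\<close> carry the pairs \<open>(m\<^sub>3, b\<^sub>0)\<close>, \<open>(m\<^sub>4, b\<^sub>1)\<close>, \<open>(m\<^sub>2, b\<^sub>3)\<close>,
  \<open>(m\<^sub>1, b\<^sub>4)\<close>. The maps \<open>\<pi>\<^sub>1, \<pi>\<^sub>2, \<pi>\<^sub>3\<close> are the Moebius changes of \<open>x\<close> that exchange
  \<open>0\<close> with \<open>1\<close>, \<open>0\<close> with \<open>t\<close>, and \<open>0\<close> with \<open>\<infinity>\<close>, and they merely exchange the corresponding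
  pairs. The map \<open>s\<close> treats all four pairs alike: it sends every \<open>b\<close> to \<open>b + (m - 1)c\<close>, and
  \<open>c\<close> to \<open>-c\<close>. In all cases the left-hand coefficient is unchanged, since the
  \<open>m - 1\<close> sum to \<open>-2\<close>.

  That a solution is carried to a solution is then the chain rule together with two identities
  of rational functions for each map (\<open>solves_normal_s\<close>, \<open>solves_normal_pi1\<close>,
  \<open>solves_normal_pi2\<close>, \<open>solves_normal_pi3\<close>). All four maps are involutions on variables and
  parameters together, so this single direction, applied once more to the image, yields the
  converse, and it yields the injectivity of the changes of variables as well
  (\<open>E_invariant_under_involution\<close>).
\<close>

section \<open>A normal form of the system\<close>

definition normal_x :: "complex \<Rightarrow> complex \<Rightarrow> complex \<Rightarrow> complex \<Rightarrow> complex \<Rightarrow> complex \<Rightarrow> complex \<Rightarrow> complex"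
  where "normal_x b1 b3 b4 c x y t =
    x*(x - 1)*(t - x)*y + (b1 - c)*x^2 + (c - b1 + b3*(t - 1) + b4*t)*x - b4*t"

definition normal_y :: "complex \<Rightarrow> complex \<Rightarrow> complex \<Rightarrow>
    complex \<Rightarrow> complex \<Rightarrow> complex \<Rightarrow> complex \<Rightarrow> complex \<Rightarrow> complex \<Rightarrow> complex \<Rightarrow> complex"
  where "normal_y m1 m2 m3 b1 b3 b4 c x y t =
    ((m1 + m2 + m3)*x^2 - (m1 + m3 + (m1 + m2)*t)*x + m1*t)*y^2
    + ((2*(m1 + m2 + m3)*c - c - 2*b1)*x + b1 + ((1 - m1 - m2)*t - m1 - m3)*c
       - b3*(t - 1) - b4*t)*y
    - c*(b1 + (1 - m1 - m2 - m3)*c)"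

text \<open>
  The derivatives are named by existential quantifiers, so that the differential equations are
  polynomial relations between plain numbers once a point \<open>t\<close> is chosen.
\<close>

definition solves_normal :: "complex \<Rightarrow> complex \<Rightarrow> complex \<Rightarrow>
    complex \<Rightarrow> complex \<Rightarrow> complex \<Rightarrow> complex \<Rightarrow> complex \<Rightarrow>
    complex set \<Rightarrow> (complex \<Rightarrow> complex) \<Rightarrow> (complex \<Rightarrow> complex) \<Rightarrow> bool"
  where "solves_normal m1 m2 m3 b0 b1 b3 b4 c U x y \<longleftrightarrow>
    (\<forall>t\<in>U. \<exists>p q. (x has_field_derivative p) (at t) \<and> (y has_field_derivative q) (at t) \<and>
       (b0 + b1 + b3 + b4 - c)*t*(t - 1)*p = normal_x b1 b3 b4 c (x t) (y t) t \<and>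
       (b0 + b1 + b3 + b4 - c)*t*(t - 1)*q = normal_y m1 m2 m3 b1 b3 b4 c (x t) (y t) t)"

text \<open>
  This makes \<open>n\<^sub>4\<close> appear on the same footing as the other three \<open>n\<^sub>i\<close>, and it shows that
  \<open>\<kappa>\<close>, by which the formula for \<open>s\<close> divides, is nonzero when \<open>n\<^sub>4\<close> is.
\<close>

lemma kappa_eq:
  assumes nz: "n1 \<noteq> 0" "n2 \<noteq> 0" "n3 \<noteq> 0" and sum: "1/n1 + 1/n2 + 1/n3 + 1/n4 = 2"
  shows "kappa (n1, n2, n3, n4) = n1*n2*n3 / n4"
proof -
  have "1/n4 = 2 - 1/n1 - 1/n2 - 1/n3"
    using sum by (simp add: algebra_simps)
  then have "n1*n2*n3*(1/n4) = n1*n2*n3*(2 - 1/n1 - 1/n2 - 1/n3)"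
    by simp
  then show ?thesis
    using nz by (simp add: algebra_simps)
qed

lemma delta_eq:
  assumes "n1 \<noteq> 0" "n2 \<noteq> 0" "n3 \<noteq> 0" "n4 \<noteq> 0" "1/n1 + 1/n2 + 1/n3 + 1/n4 = 2"
  shows "delta (n1, n2, n3, n4) (a0, a1, a2, a3, a4)
    = n1*n2*n3 * (a0/n3 + a1/n4 + a3/n2 + a4/n1 - a2)"
  using assms(1-4) unfolding delta.simps kappa_eq[OF assms(1-3,5)] by (simp add: field_simps)

lemma solves_E_iff_normal:
  assumes adm: "admissible (n1, n2, n3, n4) (a0, a1, a2, a3, a4)"
  shows "solves_E (n1, n2, n3, n4) (a0, a1, a2, a3, a4) U x y \<longleftrightarrow>
    solves_normal (1/n1) (1/n2) (1/n3) (a0/n3) (a1/n4) (a3/n2) (a4/n1) a2 U x y"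
proof -
  define N where "N = n1*n2*n3"
  have nz: "n1 \<noteq> 0" "n2 \<noteq> 0" "n3 \<noteq> 0" "n4 \<noteq> 0" and sum: "1/n1 + 1/n2 + 1/n3 + 1/n4 = 2"
    using adm by simp_all
  then have N: "N \<noteq> 0" by (simp add: N_def)
  note kap = kappa_eq[OF nz(1-3) sum]
  note d = delta_eq[OF nz sum, folded N_def]
  have rx: "rhs_x (n1, n2, n3, n4) (a0, a1, a2, a3, a4) (u, v, t) =
      N * normal_x (a1/n4) (a3/n2) (a4/n1) a2 u v t" for u v t
    using nz unfolding rhs_x.simps kap N_def normal_x_def Let_def by (simp add: field_simps)
  have ry: "rhs_y (n1, n2, n3, n4) (a0, a1, a2, a3, a4) (u, v, t) =
      N * normal_y (1/n1) (1/n2) (1/n3) (a1/n4) (a3/n2) (a4/n1) a2 u v t" for u v t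
    using nz unfolding rhs_y.simps kap N_def normal_y_def Let_def by (simp add: field_simps)
  have cancel: "N * S * t * (t - 1) * p = N * r \<longleftrightarrow> S * t * (t - 1) * p = r" for S t p r
    using N by (simp add: mult.assoc)
  show ?thesis
    unfolding solves_E_def solves_normal_def d rx ry cancel
    by (metis DERIV_imp_deriv DERIV_deriv_iff_field_differentiable)
qed

section \<open>Transport of solutions under a change of variables\<close>

text \<open>
  The new unknowns are functions of \<open>s = \<phi> t\<close>. As \<open>\<phi>\<close> is its own inverse, they are
  \<open>f (x (\<phi> s)) (y (\<phi> s)) (\<phi> s)\<close> and the same with \<open>g\<close>, at least on the open set \<open>\<phi> ` U\<close>,
  which is enough to differentiate them. What remains for a concrete map is the hypothesis
  \<open>step\<close>, a computation at one point.
\<close>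

lemma solves_normal_transport:
  assumes sol: "solves_normal m1 m2 m3 b0 b1 b3 b4 c U x y"
    and op: "open (\<phi> ` U)"
    and inv: "\<And>t. t \<in> U \<Longrightarrow> \<phi> (\<phi> t) = t"
    and deriv: "\<And>t. t \<in> U \<Longrightarrow> (\<phi> has_field_derivative d t) (at (\<phi> t))"
    and XY: "\<And>t. t \<in> U \<Longrightarrow> X (\<phi> t) = f (x t) (y t) t" "\<And>t. t \<in> U \<Longrightarrow> Y (\<phi> t) = g (x t) (y t) t"
    and step: "\<And>t p q. t \<in> U \<Longrightarrow>
      ((\<lambda>s. x (\<phi> s)) has_field_derivative p * d t) (at (\<phi> t)) \<Longrightarrow>
      ((\<lambda>s. y (\<phi> s)) has_field_derivative q * d t) (at (\<phi> t)) \<Longrightarrow>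
      (b0 + b1 + b3 + b4 - c)*t*(t - 1)*p = normal_x b1 b3 b4 c (x t) (y t) t \<Longrightarrow>
      (b0 + b1 + b3 + b4 - c)*t*(t - 1)*q = normal_y m1 m2 m3 b1 b3 b4 c (x t) (y t) t \<Longrightarrow>
      \<exists>P Q. ((\<lambda>s. f (x (\<phi> s)) (y (\<phi> s)) (\<phi> s)) has_field_derivative P) (at (\<phi> t)) \<and>
        ((\<lambda>s. g (x (\<phi> s)) (y (\<phi> s)) (\<phi> s)) has_field_derivative Q) (at (\<phi> t)) \<and>
        (b0' + b1' + b3' + b4' - c')*\<phi> t*(\<phi> t - 1)*P
          = normal_x b1' b3' b4' c' (f (x t) (y t) t) (g (x t) (y t) t) (\<phi> t) \<and>
        (b0' + b1' + b3' + b4' - c')*\<phi> t*(\<phi> t - 1)*Q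
          = normal_y m1' m2' m3' b1' b3' b4' c' (f (x t) (y t) t) (g (x t) (y t) t) (\<phi> t)"
  shows "solves_normal m1' m2' m3' b0' b1' b3' b4' c' (\<phi> ` U) X Y"
  unfolding solves_normal_def
proof
  fix s assume "s \<in> \<phi> ` U"
  then obtain t where t: "t \<in> U" and s: "s = \<phi> t" by blast
  obtain p q where pq: "(x has_field_derivative p) (at t)" "(y has_field_derivative q) (at t)"
      "(b0 + b1 + b3 + b4 - c)*t*(t - 1)*p = normal_x b1 b3 b4 c (x t) (y t) t"
      "(b0 + b1 + b3 + b4 - c)*t*(t - 1)*q = normal_y m1 m2 m3 b1 b3 b4 c (x t) (y t) t"
    using sol t unfolding solves_normal_def by blast
  have "((\<lambda>s. x (\<phi> s)) has_field_derivative p * d t) (at (\<phi> t))"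
       "((\<lambda>s. y (\<phi> s)) has_field_derivative q * d t) (at (\<phi> t))"
    using DERIV_chain2[OF _ deriv[OF t]] pq(1,2) inv[OF t] by metis+
  from step[OF t this pq(3,4)] obtain P Q where PQ:
    "((\<lambda>s. f (x (\<phi> s)) (y (\<phi> s)) (\<phi> s)) has_field_derivative P) (at s)"
    "((\<lambda>s. g (x (\<phi> s)) (y (\<phi> s)) (\<phi> s)) has_field_derivative Q) (at s)"
    and eqs: "(b0' + b1' + b3' + b4' - c') * s*(s - 1)*P = normal_x b1' b3' b4' c' (X s) (Y s) s"
    "(b0' + b1' + b3' + b4' - c') * s*(s - 1)*Q = normal_y m1' m2' m3' b1' b3' b4' c' (X s) (Y s) s"
    unfolding s XY(1)[OF t] XY(2)[OF t] by blast
  have "(X has_field_derivative P) (at s)"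
    by (rule has_field_derivative_transform_within_open[OF PQ(1) op \<open>s \<in> \<phi> ` U\<close>])
       (auto simp: XY inv)
  moreover have "(Y has_field_derivative Q) (at s)"
    by (rule has_field_derivative_transform_within_open[OF PQ(2) op \<open>s \<in> \<phi> ` U\<close>])
       (auto simp: XY inv)
  ultimately show "\<exists>P Q. (X has_field_derivative P) (at s) \<and> (Y has_field_derivative Q) (at s) \<and>
      (b0' + b1' + b3' + b4' - c') * s*(s - 1)*P = normal_x b1' b3' b4' c' (X s) (Y s) s \<and>
      (b0' + b1' + b3' + b4' - c') * s*(s - 1)*Q = normal_y m1' m2' m3' b1' b3' b4' c' (X s) (Y s) s"
    using eqs by blast
qed

text \<open>
  If \<open>T\<close> is an involution for all admissible parameters at once, then the statement that \<open>T\<close> carries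
  solutions to solutions also holds at the image parameters, where it says that \<open>T\<close> carries
  the new solutions back. Openness of \<open>\<phi> ` U\<close> is needed for the second application; it holds because
  \<open>\<phi> ` U\<close> is the preimage of \<open>U\<close> under the continuous map \<open>\<phi>\<close>.
\<close>

lemma E_invariant_under_involution:
  assumes adm: "admissible n \<alpha>"
    and adm': "\<And>n \<alpha>. admissible n \<alpha> \<Longrightarrow> admissible (N n \<alpha>) (A n \<alpha>)"
    and T: "\<And>x y t n \<alpha>. admissible n \<alpha> \<Longrightarrow> (x, y, t) \<in> V \<Longrightarrow>
      \<exists>X Y. (X, Y, \<phi> t) \<in> V \<and> T ((x, y, t), n, \<alpha>) = ((X, Y, \<phi> t), N n \<alpha>, A n \<alpha>)"
    and TT: "\<And>v n \<alpha>. admissible n \<alpha> \<Longrightarrow> v \<in> V \<Longrightarrow> T (T (v, n, \<alpha>)) = (v, n, \<alpha>)"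
    and times: "{t. \<exists>x y. (x, y, t) \<in> V} = S" "open S"
    and cont: "continuous_on S \<phi>"
    and fwd: "\<And>n \<alpha> U x y X Y. admissible n \<alpha> \<Longrightarrow> open U \<Longrightarrow> open (\<phi> ` U) \<Longrightarrow>
      (\<And>t. t \<in> U \<Longrightarrow> \<phi> (\<phi> t) = t) \<Longrightarrow>
      (\<And>t. t \<in> U \<Longrightarrow> (x t, y t, t) \<in> V) \<Longrightarrow>
      (\<And>t. t \<in> U \<Longrightarrow> fst (T ((x t, y t, t), n, \<alpha>)) = (X (\<phi> t), Y (\<phi> t), \<phi> t)) \<Longrightarrow>
      solves_E n \<alpha> U x y \<Longrightarrow> solves_E (N n \<alpha>) (A n \<alpha>) (\<phi> ` U) X Y"
    and D: "D = {(v, n, \<alpha>) | v n \<alpha>. v \<in> V}"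
  shows "E_invariant_under D T n \<alpha>"
proof -
  have inv: "\<phi> t \<in> S \<and> \<phi> (\<phi> t) = t" if t: "t \<in> S" for t
  proof -
    obtain x y where v: "(x, y, t) \<in> V" using t times(1) by blast
    obtain X Y where 1: "(X, Y, \<phi> t) \<in> V" "T ((x, y, t), n, \<alpha>) = ((X, Y, \<phi> t), N n \<alpha>, A n \<alpha>)"
      using T[OF adm v] by blast
    obtain X' Y' where "T ((X, Y, \<phi> t), N n \<alpha>, A n \<alpha>)
        = ((X', Y', \<phi> (\<phi> t)), N (N n \<alpha>) (A n \<alpha>), A (N n \<alpha>) (A n \<alpha>))"
      using T[OF adm'[OF adm] 1(1)] by blast
    with TT[OF adm v] 1 times(1) show ?thesis by auto
  qed
  have opn: "open (\<phi> ` U)" if "open U" "U \<subseteq> S" for U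
  proof -
    have "\<phi> ` U = S \<inter> \<phi> -` U"
      using that(2) inv by (auto simp: image_iff) (metis subsetD)+
    then show ?thesis
      using continuous_open_preimage[OF cont times(2) that(1)] by simp
  qed
  have transport: "solves_E n \<alpha> U x y \<longleftrightarrow> solves_E (N n \<alpha>) (A n \<alpha>) (\<phi> ` U) X Y"
    if U: "open U" and xy: "\<And>t. t \<in> U \<Longrightarrow> (x t, y t, t) \<in> V"
      and XY: "\<And>t. t \<in> U \<Longrightarrow> fst (T ((x t, y t, t), n, \<alpha>)) = (X (\<phi> t), Y (\<phi> t), \<phi> t)"
    for U x y X Y
  proof (cases "U = {}")
    case True
    then show ?thesis by (simp add: solves_E_def)
  next
    case False
    have US: "U \<subseteq> S" using xy times(1) by blast
    have image_image: "\<phi> ` (\<phi> ` U) = U" using US inv by (force simp: image_iff)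
    have image: "(X (\<phi> t), Y (\<phi> t), \<phi> t) \<in> V \<and>
        T ((X (\<phi> t), Y (\<phi> t), \<phi> t), N n \<alpha>, A n \<alpha>) = ((x t, y t, t), n, \<alpha>)" if "t \<in> U" for t
      using T[OF adm xy[OF that]] XY[OF that] TT[OF adm xy[OF that]] by auto
    \<comment> \<open>a point of \<open>V\<close> is required to read off the parameters of \<open>T (T v)\<close>\<close>
    have params: "N (N n \<alpha>) (A n \<alpha>) = n \<and> A (N n \<alpha>) (A n \<alpha>) = \<alpha>"
    proof -
      obtain t where "t \<in> U" using False by blast
      then show ?thesis using image T[OF adm'[OF adm]] by (metis Pair_inject)
    qed
    show ?thesis
    proof
      assume "solves_E n \<alpha> U x y"
      then show "solves_E (N n \<alpha>) (A n \<alpha>) (\<phi> ` U) X Y"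
        using fwd[OF adm U opn[OF U US]] US inv xy XY by blast
    next
      assume sol: "solves_E (N n \<alpha>) (A n \<alpha>) (\<phi> ` U) X Y"
      have "solves_E (N (N n \<alpha>) (A n \<alpha>)) (A (N n \<alpha>) (A n \<alpha>)) (\<phi> ` (\<phi> ` U)) x y"
      proof (rule fwd[OF adm'[OF adm] opn[OF U US] _ _ _ _ sol])
        show "open (\<phi> ` (\<phi> ` U))" using image_image U by simp
      qed (use image US inv in auto)
      then show "solves_E n \<alpha> U x y" using params image_image by simp
    qed
  qed
  show ?thesis
    unfolding E_invariant_under_def
  proof (rule exI[of _ "N n \<alpha>"], rule exI[of _ "A n \<alpha>"], rule exI[of _ \<phi>], intro conjI)
    show "admissible (N n \<alpha>) (A n \<alpha>)" using adm' adm by blast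
    show "\<forall>x y t. ((x, y, t), n, \<alpha>) \<in> D \<longrightarrow>
        (\<exists>X Y. T ((x, y, t), n, \<alpha>) = ((X, Y, \<phi> t), N n \<alpha>, A n \<alpha>))"
      using T[OF adm] D by blast
    show "inj_on \<phi> {t. \<exists>x y. ((x, y, t), n, \<alpha>) \<in> D}"
      using inv times(1) D by (intro inj_on_inverseI[where g = \<phi>]) auto
    show "inj_on (\<lambda>v. fst (T (v, n, \<alpha>))) {v. (v, n, \<alpha>) \<in> D}"
    proof (rule inj_on_inverseI[where g = "\<lambda>w. fst (T (w, N n \<alpha>, A n \<alpha>))"])
      fix v assume "v \<in> {v. (v, n, \<alpha>) \<in> D}"
      then have v: "v \<in> V" using D by blast
      obtain x y t where "v = (x, y, t)" by (cases v)
      then have "T (v, n, \<alpha>) = (fst (T (v, n, \<alpha>)), N n \<alpha>, A n \<alpha>)"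
        using T[OF adm] v by fastforce
      then show "fst (T (fst (T (v, n, \<alpha>)), N n \<alpha>, A n \<alpha>)) = v"
        using TT[OF adm v] by (metis fst_conv)
    qed
    show "\<forall>U x y X Y. open U \<and>
        (\<forall>t\<in>U. ((x t, y t, t), n, \<alpha>) \<in> D \<and>
           T ((x t, y t, t), n, \<alpha>) = ((X (\<phi> t), Y (\<phi> t), \<phi> t), N n \<alpha>, A n \<alpha>)) \<longrightarrow>
        solves_E n \<alpha> U x y = solves_E (N n \<alpha>) (A n \<alpha>) (\<phi> ` U) X Y"
      using D by (intro allI impI transport) auto
  qed
qed

section \<open>The four transformations on the normal form\<close>

text \<open>
  Time is unchanged. With \<open>X = x + c/y\<close> one has \<open>X' = x' - c y'/y\<^sup>2\<close>, so the claim is that the new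
  right-hand sides are the same combinations of the old ones.
\<close>

lemma solves_normal_s:
  assumes sol: "solves_normal m1 m2 m3 b0 b1 b3 b4 c U x y" and "open U"
    and m: "m1 + m2 + m3 + m4 = 2"
    and nz: "\<And>t. t \<in> U \<Longrightarrow> y t \<noteq> 0"
    and XY: "\<And>t. t \<in> U \<Longrightarrow> X t = x t + c / y t" "\<And>t. t \<in> U \<Longrightarrow> Y t = y t"
  shows "solves_normal m1 m2 m3 (b0 + (m3 - 1)*c) (b1 + (m4 - 1)*c) (b3 + (m2 - 1)*c)
    (b4 + (m1 - 1)*c) (-c) U X Y"
proof -
  have m4: "m4 = 2 - m1 - m2 - m3" using m by (simp add: algebra_simps)
  have "solves_normal m1 m2 m3 (b0 + (m3 - 1)*c) (b1 + (m4 - 1)*c) (b3 + (m2 - 1)*c)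
    (b4 + (m1 - 1)*c) (-c) ((\<lambda>t. t) ` U) X Y"
  proof (rule solves_normal_transport[OF sol, where d = "\<lambda>_. 1" and f = "\<lambda>x y t. x + c/y"
        and g = "\<lambda>x y t. y"])
    fix t p q
    assume t: "t \<in> U"
      and der: "(x has_field_derivative p*1) (at t)" "(y has_field_derivative q*1) (at t)"
      and eqs: "(b0 + b1 + b3 + b4 - c)*t*(t - 1)*p = normal_x b1 b3 b4 c (x t) (y t) t"
        "(b0 + b1 + b3 + b4 - c)*t*(t - 1)*q = normal_y m1 m2 m3 b1 b3 b4 c (x t) (y t) t"
    let ?S = "b0 + b1 + b3 + b4 - c"
    have S: "b0 + (m3 - 1)*c + (b1 + (m4 - 1)*c) + (b3 + (m2 - 1)*c) + (b4 + (m1 - 1)*c) - - c = ?S"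
      unfolding m4 by (simp add: algebra_simps)
    have Dx: "((\<lambda>s. x s + c / y s) has_field_derivative p - c*q/(y t)^2) (at t)"
      using nz[OF t] der by (auto intro!: derivative_eq_intros simp: power2_eq_square)
    have id_x: "normal_x (b1 + (m4 - 1)*c) (b3 + (m2 - 1)*c) (b4 + (m1 - 1)*c) (-c) (u + c/v) v t
        = normal_x b1 b3 b4 c u v t - c * normal_y m1 m2 m3 b1 b3 b4 c u v t / v^2"
      if "v \<noteq> 0" for u v
      using that unfolding normal_x_def normal_y_def m4 by (simp add: field_simps power2_eq_square)
    have id_y: "normal_y m1 m2 m3 (b1 + (m4 - 1)*c) (b3 + (m2 - 1)*c) (b4 + (m1 - 1)*c) (-c) (u + c/v) v t
        = normal_y m1 m2 m3 b1 b3 b4 c u v t" if "v \<noteq> 0" for u v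
      using that unfolding normal_y_def m4 by (simp add: field_simps power2_eq_square)
    have 1: "S*t*(t - 1)*(p - c*q/(y t)^2) = S*t*(t - 1)*p - c*(S*t*(t - 1)*q)/(y t)^2" for S
      by (simp add: right_diff_distrib mult_ac)
    show "\<exists>P Q. ((\<lambda>s. x s + c / y s) has_field_derivative P) (at t) \<and>
        (y has_field_derivative Q) (at t) \<and>
        (b0 + (m3 - 1)*c + (b1 + (m4 - 1)*c) + (b3 + (m2 - 1)*c) + (b4 + (m1 - 1)*c) - - c)*t*(t - 1)*P
          = normal_x (b1 + (m4 - 1)*c) (b3 + (m2 - 1)*c) (b4 + (m1 - 1)*c) (-c) (x t + c / y t) (y t) t \<and>
        (b0 + (m3 - 1)*c + (b1 + (m4 - 1)*c) + (b3 + (m2 - 1)*c) + (b4 + (m1 - 1)*c) - - c)*t*(t - 1)*Q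
          = normal_y m1 m2 m3 (b1 + (m4 - 1)*c) (b3 + (m2 - 1)*c) (b4 + (m1 - 1)*c) (-c) (x t + c / y t) (y t) t"
      unfolding S id_x[OF nz[OF t]] id_y[OF nz[OF t]] eqs[symmetric]
      using Dx der 1 by (intro exI conjI) (assumption | simp)+
  qed (use \<open>open U\<close> XY in \<open>auto simp: image_def intro: derivative_eq_intros\<close>)
  then show ?thesis by simp
qed

text \<open>
  Reversing time and changing the signs of \<open>x\<close> and \<open>y\<close> cancel in the derivatives, and \<open>t(t - 1)\<close> is
  symmetric about \<open>1/2\<close>; hence both right-hand sides must be invariant.
\<close>

lemma solves_normal_pi1:
  assumes sol: "solves_normal m1 m2 m3 b0 b1 b3 b4 c U x y" and op: "open ((\<lambda>t. 1 - t) ` U)"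
    and XY: "\<And>t. t \<in> U \<Longrightarrow> X (1 - t) = 1 - x t" "\<And>t. t \<in> U \<Longrightarrow> Y (1 - t) = - y t"
  shows "solves_normal m2 m1 m3 b0 b1 b4 b3 c ((\<lambda>t. 1 - t) ` U) X Y"
proof (rule solves_normal_transport[OF sol op, where d = "\<lambda>_. -1" and f = "\<lambda>x y t. 1 - x"
      and g = "\<lambda>x y t. - y"])
  fix t p q
  assume t: "t \<in> U"
    and der: "((\<lambda>s. x (1 - s)) has_field_derivative p * -1) (at (1 - t))"
      "((\<lambda>s. y (1 - s)) has_field_derivative q * -1) (at (1 - t))"
    and eqs: "(b0 + b1 + b3 + b4 - c)*t*(t - 1)*p = normal_x b1 b3 b4 c (x t) (y t) t"
      "(b0 + b1 + b3 + b4 - c)*t*(t - 1)*q = normal_y m1 m2 m3 b1 b3 b4 c (x t) (y t) t"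
  have id_x: "normal_x b1 b4 b3 c (1 - u) (- v) (1 - t) = normal_x b1 b3 b4 c u v t" for u v
    unfolding normal_x_def by algebra
  have id_y: "normal_y m2 m1 m3 b1 b4 b3 c (1 - u) (- v) (1 - t)
      = normal_y m1 m2 m3 b1 b3 b4 c u v t" for u v
    unfolding normal_y_def by algebra
  have Dx: "((\<lambda>s. 1 - x (1 - s)) has_field_derivative p) (at (1 - t))"
    using der(1) by (auto intro!: derivative_eq_intros)
  have Dy: "((\<lambda>s. - y (1 - s)) has_field_derivative q) (at (1 - t))"
    using der(2) by (auto intro!: derivative_eq_intros)
  show "\<exists>P Q. ((\<lambda>s. 1 - x (1 - s)) has_field_derivative P) (at (1 - t)) \<and>
      ((\<lambda>s. - y (1 - s)) has_field_derivative Q) (at (1 - t)) \<and>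
      (b0 + b1 + b4 + b3 - c)*(1 - t)*(1 - t - 1)*P
        = normal_x b1 b4 b3 c (1 - x t) (- y t) (1 - t) \<and>
      (b0 + b1 + b4 + b3 - c)*(1 - t)*(1 - t - 1)*Q
        = normal_y m2 m1 m3 b1 b4 b3 c (1 - x t) (- y t) (1 - t)"
    unfolding id_x id_y eqs[symmetric]
    using Dx Dy by (intro exI conjI) (assumption | simp add: algebra_simps)+
qed (use XY in \<open>auto intro!: derivative_eq_intros\<close>)

text \<open>
  Here the change of variables depends on \<open>t\<close>, and differentiating it explicitly contributes the terms
  \<open>- S t (x - 1)\<close> and \<open>S t y\<close> in the two identities, \<open>S\<close> being the left-hand coefficient. As
  \<open>b\<^sub>0\<close> occurs in the system only through \<open>S\<close>, it is these terms that let \<open>b\<^sub>0\<close> and \<open>b\<^sub>4\<close> change places.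
\<close>

lemma solves_normal_pi2:
  assumes sol: "solves_normal m1 m2 m3 b0 b1 b3 b4 c U x y" and op: "open ((\<lambda>t. t/(t - 1)) ` U)"
    and nz: "\<And>t. t \<in> U \<Longrightarrow> t \<noteq> 1"
    and XY: "\<And>t. t \<in> U \<Longrightarrow> X (t/(t - 1)) = (t - x t)/(t - 1)"
      "\<And>t. t \<in> U \<Longrightarrow> Y (t/(t - 1)) = - (t - 1) * y t"
  shows "solves_normal m3 m2 m1 b4 b1 b3 b0 c ((\<lambda>t. t/(t - 1)) ` U) X Y"
proof (rule solves_normal_transport[OF sol op, where d = "\<lambda>t. - ((t - 1)^2)"
      and f = "\<lambda>x y t. (t - x)/(t - 1)" and g = "\<lambda>x y t. - (t - 1) * y"])
  show inv: "t/(t - 1)/(t/(t - 1) - 1) = t" if "t \<in> U" for t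
    using nz[OF that] by (simp add: divide_simps)
  show deriv: "((\<lambda>t. t/(t - 1)) has_field_derivative - ((t - 1)^2)) (at (t/(t - 1)))"
    if "t \<in> U" for t
  proof -
    have "t/(t - 1) - 1 = 1/(t - 1)" "t - 1 \<noteq> 0" using nz[OF that] by (simp_all add: divide_simps)
    then show ?thesis
      by (auto intro!: derivative_eq_intros simp: power2_eq_square algebra_simps)
  qed
  fix t p q
  let ?\<phi> = "\<lambda>s. s/(s - 1)"
  assume t: "t \<in> U"
    and der: "((\<lambda>s. x (?\<phi> s)) has_field_derivative p * - ((t - 1)^2)) (at (?\<phi> t))"
      "((\<lambda>s. y (?\<phi> s)) has_field_derivative q * - ((t - 1)^2)) (at (?\<phi> t))"
    and eqs: "(b0 + b1 + b3 + b4 - c)*t*(t - 1)*p = normal_x b1 b3 b4 c (x t) (y t) t"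
      "(b0 + b1 + b3 + b4 - c)*t*(t - 1)*q = normal_y m1 m2 m3 b1 b3 b4 c (x t) (y t) t"
  let ?S = "b0 + b1 + b3 + b4 - c"
  have t1: "t \<noteq> 1" "t - 1 \<noteq> 0" using nz[OF t] by simp_all
  have id_x: "(t - 1)^2 * normal_x b1 b3 b0 c ((t - u)/(t - 1)) (- (t - 1) * v) (?\<phi> t)
      = normal_x b1 b3 b4 c u v t - ?S*t*(u - 1)" for u v
    using t1(1) unfolding normal_x_def by (simp add: divide_simps) algebra
  have id_y: "normal_y m3 m2 m1 b1 b3 b0 c ((t - u)/(t - 1)) (- (t - 1) * v) (?\<phi> t)
      = normal_y m1 m2 m3 b1 b3 b4 c u v t + ?S*t * v" for u v
    using t1(1) unfolding normal_y_def by (simp add: divide_simps) algebra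
  let ?P = "(t - 1)*p - (x t - 1)" and ?Q = "(t - 1)^2*((t - 1)*q + y t)"
  \<comment> \<open>stated for an arbitrary \<open>h\<close> in place of \<open>\<phi>\<close>, so that the known derivative of \<open>\<phi>\<close> is used as it
    stands and the rule for quotients is not applied to \<open>\<phi>\<close> itself\<close>
  have quotient: "((\<lambda>s. (h s - a s)/(h s - 1)) has_field_derivative
      ((d - e)*(h r - 1) - (h r - a r)*d)/((h r - 1)*(h r - 1))) (at r)"
    if "(h has_field_derivative d) (at r)" "(a has_field_derivative e) (at r)" "h r - 1 \<noteq> 0"
    for h a :: "complex \<Rightarrow> complex" and d e r
    using that by (auto intro!: derivative_eq_intros)
  have P: "((- ((t - 1)^2) - p * - ((t - 1)^2))*(t - 1) - (t - x t)* - ((t - 1)^2))/((t - 1)*(t - 1)) = ?P"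
    using t1 by (simp add: divide_simps) algebra
  have Dx: "((\<lambda>s. (?\<phi> s - x (?\<phi> s))/(?\<phi> s - 1)) has_field_derivative ?P) (at (?\<phi> t))"
    using quotient[OF deriv[OF t] der(1)] t1 unfolding inv[OF t] P by blast
  have product: "((\<lambda>s. - (h s - 1) * a s) has_field_derivative - d * a r - (h r - 1)*e) (at r)"
    if "(h has_field_derivative d) (at r)" "(a has_field_derivative e) (at r)"
    for h a :: "complex \<Rightarrow> complex" and d e r
    using that by (auto intro!: derivative_eq_intros simp: algebra_simps)
  have Q: "- (- ((t - 1)^2)) * y t - (t - 1)*(q * - ((t - 1)^2)) = ?Q"
    by algebra
  have Dy: "((\<lambda>s. - (?\<phi> s - 1) * y (?\<phi> s)) has_field_derivative ?Q) (at (?\<phi> t))"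
    using product[OF deriv[OF t] der(2)] unfolding inv[OF t] Q .
  have S: "b4 + b1 + b3 + b0 - c = ?S" by (simp add: algebra_simps)
  have scale: "(t - 1)^2 * (r*?\<phi> t*(?\<phi> t - 1) * v) = r*t * v" for r v
    using t1 by (simp add: divide_simps power2_eq_square)
  show "\<exists>P Q. ((\<lambda>s. (?\<phi> s - x (?\<phi> s))/(?\<phi> s - 1)) has_field_derivative P) (at (?\<phi> t)) \<and>
      ((\<lambda>s. - (?\<phi> s - 1) * y (?\<phi> s)) has_field_derivative Q) (at (?\<phi> t)) \<and>
      (b4 + b1 + b3 + b0 - c)*?\<phi> t*(?\<phi> t - 1)*P
        = normal_x b1 b3 b0 c ((t - x t)/(t - 1)) (- (t - 1) * y t) (?\<phi> t) \<and>
      (b4 + b1 + b3 + b0 - c)*?\<phi> t*(?\<phi> t - 1)*Q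
        = normal_y m3 m2 m1 b1 b3 b0 c ((t - x t)/(t - 1)) (- (t - 1) * y t) (?\<phi> t)"
  proof (intro exI conjI)
    have "(t - 1)^2 * (?S*?\<phi> t*(?\<phi> t - 1)*?P) = ?S*t*(t - 1)*p - ?S*t*(x t - 1)"
      unfolding scale by algebra
    also have "\<dots> = (t - 1)^2 * normal_x b1 b3 b0 c ((t - x t)/(t - 1)) (- (t - 1) * y t) (?\<phi> t)"
      unfolding id_x eqs ..
    finally show "(b4 + b1 + b3 + b0 - c)*?\<phi> t*(?\<phi> t - 1)*?P
        = normal_x b1 b3 b0 c ((t - x t)/(t - 1)) (- (t - 1) * y t) (?\<phi> t)"
      unfolding S mult_left_cancel[OF power_not_zero[OF t1(2)]] .
    have "?S*?\<phi> t*(?\<phi> t - 1)*?Q = (t - 1)^2 * (?S*?\<phi> t*(?\<phi> t - 1)*((t - 1)*q + y t))"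
      by (simp only: mult_ac)
    also have "\<dots> = ?S*t*(t - 1)*q + ?S*t*y t"
      unfolding scale by (simp only: distrib_left mult.assoc)
    finally show "(b4 + b1 + b3 + b0 - c)*?\<phi> t*(?\<phi> t - 1)*?Q
        = normal_y m3 m2 m1 b1 b3 b0 c ((t - x t)/(t - 1)) (- (t - 1) * y t) (?\<phi> t)"
      unfolding S id_y eqs .
  qed (fact Dx Dy)+
qed (use XY in auto)

text \<open>
  The equation for \<open>y\<close> picks up a multiple of that for \<open>x\<close>, because \<open>Y = - (x\<^sup>2y + cx)\<close> has
  \<open>Y' = - (2xy + c) x' - x\<^sup>2 y'\<close>. Both identities are multiplied by \<open>t\<close>, as
  \<open>s(s - 1) dt/ds = (t - 1)\<close> for \<open>s = 1/t\<close>, which is \<open>t(t - 1)\<close> divided by \<open>t\<close>.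
\<close>

lemma solves_normal_pi3:
  assumes sol: "solves_normal m1 m2 m3 b0 b1 b3 b4 c U x y" and op: "open ((\<lambda>t. 1/t) ` U)"
    and m: "m1 + m2 + m3 + m4 = 2"
    and nz: "\<And>t. t \<in> U \<Longrightarrow> x t \<noteq> 0 \<and> t \<noteq> 0"
    and XY: "\<And>t. t \<in> U \<Longrightarrow> X (1/t) = 1 / x t"
      "\<And>t. t \<in> U \<Longrightarrow> Y (1/t) = - (y t * x t + c) * x t"
  shows "solves_normal m4 m2 m3 b0 b4 b3 b1 c ((\<lambda>t. 1/t) ` U) X Y"
proof (rule solves_normal_transport[OF sol op, where d = "\<lambda>t. - (t^2)"
      and f = "\<lambda>x y t. 1/x" and g = "\<lambda>x y t. - (y*x + c)*x"])
  have m4: "m4 = 2 - m1 - m2 - m3" using m by (simp add: algebra_simps)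
  fix t p q
  assume t: "t \<in> U"
    and der: "((\<lambda>s. x (1/s)) has_field_derivative p * - (t^2)) (at (1/t))"
      "((\<lambda>s. y (1/s)) has_field_derivative q * - (t^2)) (at (1/t))"
    and eqs: "(b0 + b1 + b3 + b4 - c)*t*(t - 1)*p = normal_x b1 b3 b4 c (x t) (y t) t"
      "(b0 + b1 + b3 + b4 - c)*t*(t - 1)*q = normal_y m1 m2 m3 b1 b3 b4 c (x t) (y t) t"
  let ?S = "b0 + b1 + b3 + b4 - c"
  have t0: "t \<noteq> 0" and x0: "x t \<noteq> 0" using nz[OF t] by simp_all
  have id_x: "t * normal_x b4 b3 b1 c (1/u) (- (v * u + c)*u) (1/t) = - normal_x b1 b3 b4 c u v t / u^2"
    if "u \<noteq> 0" for u v
    using t0 that unfolding normal_x_def by (simp add: field_simps power2_eq_square)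
  have id_y: "t * normal_y m4 m2 m3 b4 b3 b1 c (1/u) (- (v * u + c)*u) (1/t)
      = - (2 * v * u + c)*normal_x b1 b3 b4 c u v t - u^2 * normal_y m1 m2 m3 b1 b3 b4 c u v t"
    if "u \<noteq> 0" for u v
    using t0 that unfolding normal_x_def normal_y_def m4 by (simp add: field_simps power2_eq_square)
  let ?P = "t^2 * p / (x t)^2" and ?Q = "t^2 * ((2*y t*x t + c)*p + (x t)^2*q)"
  have Dx: "((\<lambda>s. 1 / x (1/s)) has_field_derivative ?P) (at (1/t))"
    using x0 der(1) by (auto intro!: derivative_eq_intros simp: power2_eq_square)
  have Dy: "((\<lambda>s. - (y (1/s) * x (1/s) + c) * x (1/s)) has_field_derivative ?Q) (at (1/t))"
    by (rule derivative_eq_intros der refl)+ (simp add: algebra_simps power2_eq_square)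
  have scale: "t * (1/t * (1/t - 1) * t^2) = - (t * (t - 1))"
    using t0 by (simp add: field_simps power2_eq_square)
  show "\<exists>P Q. ((\<lambda>s. 1 / x (1/s)) has_field_derivative P) (at (1/t)) \<and>
      ((\<lambda>s. - (y (1/s) * x (1/s) + c) * x (1/s)) has_field_derivative Q) (at (1/t)) \<and>
      (b0 + b4 + b3 + b1 - c)*(1/t)*(1/t - 1)*P
        = normal_x b4 b3 b1 c (1 / x t) (- (y t * x t + c) * x t) (1/t) \<and>
      (b0 + b4 + b3 + b1 - c)*(1/t)*(1/t - 1)*Q
        = normal_y m4 m2 m3 b4 b3 b1 c (1 / x t) (- (y t * x t + c) * x t) (1/t)"
  proof (intro exI conjI)
    have "t * ((b0 + b4 + b3 + b1 - c)*(1/t)*(1/t - 1)*?P) = ?S * (t * (1/t * (1/t - 1) * t^2)) * p / (x t)^2"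
      by (simp add: mult_ac add_ac)
    also have "\<dots> = - (?S*t*(t - 1)*p) / (x t)^2"
      unfolding scale by (simp add: mult_ac)
    also have "\<dots> = t * normal_x b4 b3 b1 c (1 / x t) (- (y t * x t + c) * x t) (1/t)"
      unfolding id_x[OF x0] eqs ..
    finally show "(b0 + b4 + b3 + b1 - c)*(1/t)*(1/t - 1)*?P
        = normal_x b4 b3 b1 c (1 / x t) (- (y t * x t + c) * x t) (1/t)"
      unfolding mult_left_cancel[OF t0] .
    have "t * ((b0 + b4 + b3 + b1 - c)*(1/t)*(1/t - 1)*?Q)
        = ?S * (t * (1/t * (1/t - 1) * t^2)) * ((2*y t*x t + c)*p + (x t)^2*q)"
      by (simp add: mult_ac add_ac)
    also have "\<dots> = - (2*y t*x t + c)*(?S*t*(t - 1)*p) - (x t)^2*(?S*t*(t - 1)*q)"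
      unfolding scale by (simp add: algebra_simps)
    also have "\<dots> = t * normal_y m4 m2 m3 b4 b3 b1 c (1 / x t) (- (y t * x t + c) * x t) (1/t)"
      unfolding id_y[OF x0] eqs ..
    finally show "(b0 + b4 + b3 + b1 - c)*(1/t)*(1/t - 1)*?Q
        = normal_y m4 m2 m3 b4 b3 b1 c (1 / x t) (- (y t * x t + c) * x t) (1/t)"
      unfolding mult_left_cancel[OF t0] .
  qed (fact Dx Dy)+
next
  show "((\<lambda>t. 1/t) has_field_derivative - (t^2)) (at (1/t))" if "t \<in> U" for t
    using nz[OF that] by (auto intro!: derivative_eq_intros simp: power2_eq_square)
qed (use XY in auto)

section \<open>Invariance of the system\<close>

text \<open>
  The second new parameter is the image of \<open>\<alpha>\<^sub>1\<close> under the rule for the other ones: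
  \<open>n\<^sub>1n\<^sub>2n\<^sub>3 - n\<^sub>1n\<^sub>2 - n\<^sub>1n\<^sub>3 - n\<^sub>2n\<^sub>3 = \<kappa> - n\<^sub>1n\<^sub>2n\<^sub>3 = \<kappa>(1 - n\<^sub>4)\<close>.
\<close>

lemma s_map_eq:
  assumes adm: "admissible (n1, n2, n3, n4) (a0, a1, a2, a3, a4)"
  shows "s_map ((x, y, t), (n1, n2, n3, n4), (a0, a1, a2, a3, a4)) =
    ((x + a2/y, y, t), (n1, n2, n3, n4),
     (a0 + (1 - n3)*a2, a1 + (1 - n4)*a2, - a2, a3 + (1 - n2)*a2, a4 + (1 - n1)*a2))"
proof -
  define k where "k = kappa (n1, n2, n3, n4)"
  have nz: "n1 \<noteq> 0" "n2 \<noteq> 0" "n3 \<noteq> 0" "n4 \<noteq> 0" and sum: "1/n1 + 1/n2 + 1/n3 + 1/n4 = 2"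
    using adm by simp_all
  have k0: "k \<noteq> 0" and kn4: "k*n4 = n1*n2*n3"
    using kappa_eq[OF nz(1-3) sum] nz by (simp_all add: k_def)
  have "n1*n2*n3 - n1*n2 - n1*n3 - n2*n3 = k*(1 - n4)"
    using kn4 by (simp add: k_def algebra_simps)
  then have "(k*a1 + (n1*n2*n3 - n1*n2 - n1*n3 - n2*n3)*a2)/k = a1 + (1 - n4)*a2"
    using k0 by (simp add: add_divide_distrib)
  then show ?thesis
    by (simp add: Let_def k_def[symmetric] algebra_simps del: kappa.simps)
qed

lemma pi3_map_eq:
  assumes adm: "admissible (n1, n2, n3, n4) (a0, a1, a2, a3, a4)"
  shows "pi3_map ((x, y, t), (n1, n2, n3, n4), (a0, a1, a2, a3, a4)) =
    ((1/x, - (y*x + a2)*x, 1/t), (n4, n2, n3, n1), (a0, a4, a2, a3, a1))"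
  using adm kappa_eq[of n1 n2 n3 n4] by (simp add: Let_def del: kappa.simps delta.simps)

lemma E_invariant_under_s:
  assumes "admissible n \<alpha>"
  shows "E_invariant_under s_dom s_map n \<alpha>"
proof (rule E_invariant_under_involution[OF assms, where V = "{(x, y, t). y \<noteq> 0}" and S = UNIV
      and \<phi> = "\<lambda>t. t" and N = "\<lambda>n _. n"
      and A = "\<lambda>(n1, n2, n3, n4) (a0, a1, a2, a3, a4).
        (a0 + (1 - n3)*a2, a1 + (1 - n4)*a2, - a2, a3 + (1 - n2)*a2, a4 + (1 - n1)*a2)"],
    goal_cases)
  have adm': "admissible (n1, n2, n3, n4)
      (a0 + (1 - n3)*a2, a1 + (1 - n4)*a2, - a2, a3 + (1 - n2)*a2, a4 + (1 - n1)*a2)"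
    if adm: "admissible (n1, n2, n3, n4) (a0, a1, a2, a3, a4)" for n1 n2 n3 n4 a0 a1 a2 a3 a4
  proof -
    have nz: "n1 \<noteq> 0" "n2 \<noteq> 0" "n3 \<noteq> 0" "n4 \<noteq> 0" and sum: "1/n1 + 1/n2 + 1/n3 + 1/n4 = 2"
      using adm by simp_all
    have "(a0 + (1 - n3)*a2)/n3 + (a1 + (1 - n4)*a2)/n4 + (a3 + (1 - n2)*a2)/n2
          + (a4 + (1 - n1)*a2)/n1 - - a2
        = a0/n3 + a1/n4 + a3/n2 + a4/n1 + (1/n1 + 1/n2 + 1/n3 + 1/n4 - 3)*a2"
      using nz by (simp add: add_divide_distrib left_diff_distrib distrib_right diff_divide_distrib)
    then have "delta (n1, n2, n3, n4) (a0 + (1 - n3)*a2, a1 + (1 - n4)*a2, - a2,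
          a3 + (1 - n2)*a2, a4 + (1 - n1)*a2) = delta (n1, n2, n3, n4) (a0, a1, a2, a3, a4)"
      unfolding delta_eq[OF nz sum] sum by simp
    then show ?thesis using adm by (simp del: delta.simps)
  qed
  {
    case (1 n \<alpha>)
    then show ?case using adm' by (cases n; cases \<alpha>) (simp del: admissible.simps)
  next
    case (2 x y t n \<alpha>)
    then show ?case by (cases n; cases \<alpha>) (simp add: s_map_eq del: s_map.simps admissible.simps)
  next
    case (3 v n \<alpha>)
    then show ?case
      by (cases v; cases n; cases \<alpha>)
         (simp add: s_map_eq adm' del: s_map.simps admissible.simps)
  next
    case 4
    then show ?case by (auto intro: exI[of _ "1::complex"])
  next
    case (7 n \<alpha> U x y X Y)
    obtain n1 n2 n3 n4 where n: "n = (n1, n2, n3, n4)" by (cases n)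
    obtain a0 a1 a2 a3 a4 where \<alpha>: "\<alpha> = (a0, a1, a2, a3, a4)" by (cases \<alpha>)
    note adm = 7(1)[unfolded n \<alpha>]
    have nz: "n1 \<noteq> 0" "n2 \<noteq> 0" "n3 \<noteq> 0" "n4 \<noteq> 0" and sum: "1/n1 + 1/n2 + 1/n3 + 1/n4 = 2"
      using adm by simp_all
    have b: "(a + (1 - k)*a2)/k = a/k + (1/k - 1)*a2" if "k \<noteq> 0" for a k
      using that by (simp add: field_simps)
    have XY: "X t = x t + a2 / y t \<and> Y t = y t" if "t \<in> U" for t
      using 7(6)[OF that] unfolding n \<alpha> s_map_eq[OF adm] fst_conv prod.inject by metis
    have "solves_normal (1/n1) (1/n2) (1/n3) (a0/n3 + (1/n3 - 1)*a2) (a1/n4 + (1/n4 - 1)*a2)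
        (a3/n2 + (1/n2 - 1)*a2) (a4/n1 + (1/n1 - 1)*a2) (- a2) U X Y"
      using 7(2,5) XY 7(7)[unfolded n \<alpha> solves_E_iff_normal[OF adm]]
      by (intro solves_normal_s[where x = x and y = y, OF _ _ sum]) simp_all
    then show ?case
      unfolding n \<alpha> using solves_E_iff_normal[OF adm'[OF adm]] nz by (simp add: b)
  }
qed (auto simp: s_dom_def)

lemma E_invariant_under_pi1:
  assumes "admissible n \<alpha>"
  shows "E_invariant_under UNIV pi1_map n \<alpha>"
proof (rule E_invariant_under_involution[OF assms, where V = UNIV and S = UNIV
      and \<phi> = "\<lambda>t. 1 - t" and N = "\<lambda>(n1, n2, n3, n4) _. (n2, n1, n3, n4)"
      and A = "\<lambda>_ (a0, a1, a2, a3, a4). (a0, a1, a2, a4, a3)"],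
    goal_cases)
  have adm': "admissible (n2, n1, n3, n4) (a0, a1, a2, a4, a3)"
    if "admissible (n1, n2, n3, n4) (a0, a1, a2, a3, a4)" for n1 n2 n3 n4 a0 a1 a2 a3 a4
    using that by (simp add: algebra_simps)
  {
    case (1 n \<alpha>)
    then show ?case using adm' by (cases n; cases \<alpha>) (simp del: admissible.simps)
  next
    case (2 x y t n \<alpha>)
    then show ?case by (cases n; cases \<alpha>) simp
  next
    case (3 v n \<alpha>)
    then show ?case by (cases v; cases n; cases \<alpha>) simp
  next
    case (7 n \<alpha> U x y X Y)
    obtain n1 n2 n3 n4 where n: "n = (n1, n2, n3, n4)" by (cases n)
    obtain a0 a1 a2 a3 a4 where \<alpha>: "\<alpha> = (a0, a1, a2, a3, a4)" by (cases \<alpha>)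
    note adm = 7(1)[unfolded n \<alpha>]
    have "solves_normal (1/n2) (1/n1) (1/n3) (a0/n3) (a1/n4) (a4/n1) (a3/n2) a2
        ((\<lambda>t. 1 - t) ` U) X Y"
      using 7(3,6) 7(7)[unfolded n \<alpha> solves_E_iff_normal[OF adm]]
      by (intro solves_normal_pi1) (auto simp: n \<alpha>)
    then show ?case
      unfolding n \<alpha> using solves_E_iff_normal[OF adm'[OF adm]] by simp
  }
qed (auto intro: continuous_intros)

lemma E_invariant_under_pi2:
  assumes "admissible n \<alpha>"
  shows "E_invariant_under pi2_dom pi2_map n \<alpha>"
proof (rule E_invariant_under_involution[OF assms, where V = "{(x, y, t). t \<noteq> 1}" and S = "- {1}"
      and \<phi> = "\<lambda>t. t/(t - 1)" and N = "\<lambda>(n1, n2, n3, n4) _. (n3, n2, n1, n4)"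
      and A = "\<lambda>_ (a0, a1, a2, a3, a4). (a4, a1, a2, a3, a0)"],
    goal_cases)
  have adm': "admissible (n3, n2, n1, n4) (a4, a1, a2, a3, a0)"
    if "admissible (n1, n2, n3, n4) (a0, a1, a2, a3, a4)" for n1 n2 n3 n4 a0 a1 a2 a3 a4
    using that by (simp add: algebra_simps)
  {
    case (1 n \<alpha>)
    then show ?case using adm' by (cases n; cases \<alpha>) (simp del: admissible.simps)
  next
    case (2 x y t n \<alpha>)
    then show ?case by (cases n; cases \<alpha>) (simp del: admissible.simps)
  next
    case (3 v n \<alpha>)
    obtain x y t where v: "v = (x, y, t)" by (cases v)
    have t: "t - 1 \<noteq> 0" using 3 v by simp
    have "t/(t - 1) - 1 = 1/(t - 1)" using t by (simp add: divide_simps)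
    then show ?case
      using t unfolding v by (cases n; cases \<alpha>) (simp add: diff_divide_distrib[symmetric], simp add: field_simps)
  next
    case (7 n \<alpha> U x y X Y)
    obtain n1 n2 n3 n4 where n: "n = (n1, n2, n3, n4)" by (cases n)
    obtain a0 a1 a2 a3 a4 where \<alpha>: "\<alpha> = (a0, a1, a2, a3, a4)" by (cases \<alpha>)
    note adm = 7(1)[unfolded n \<alpha>]
    have "solves_normal (1/n3) (1/n2) (1/n1) (a4/n1) (a1/n4) (a3/n2) (a0/n3) a2
        ((\<lambda>t. t/(t - 1)) ` U) X Y"
      using 7(3,5,6) 7(7)[unfolded n \<alpha> solves_E_iff_normal[OF adm]]
      by (intro solves_normal_pi2) (auto simp: n \<alpha>)
    then show ?case
      unfolding n \<alpha> using solves_E_iff_normal[OF adm'[OF adm]] by simp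
  }
qed (auto simp: pi2_dom_def intro!: continuous_intros)

lemma E_invariant_under_pi3:
  assumes "admissible n \<alpha>"
  shows "E_invariant_under pi3_dom pi3_map n \<alpha>"
proof (rule E_invariant_under_involution[OF assms, where V = "{(x, y, t). x \<noteq> 0 \<and> t \<noteq> 0}"
      and S = "- {0}"
      and \<phi> = "\<lambda>t. 1/t" and N = "\<lambda>(n1, n2, n3, n4) _. (n4, n2, n3, n1)"
      and A = "\<lambda>_ (a0, a1, a2, a3, a4). (a0, a4, a2, a3, a1)"],
    goal_cases)
  have adm': "admissible (n4, n2, n3, n1) (a0, a4, a2, a3, a1)"
    if adm: "admissible (n1, n2, n3, n4) (a0, a1, a2, a3, a4)" for n1 n2 n3 n4 a0 a1 a2 a3 a4
  proof -
    have nz: "n1 \<noteq> 0" "n2 \<noteq> 0" "n3 \<noteq> 0" "n4 \<noteq> 0" and sum: "1/n1 + 1/n2 + 1/n3 + 1/n4 = 2"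
      and d: "delta (n1, n2, n3, n4) (a0, a1, a2, a3, a4) \<noteq> 0"
      using adm by simp_all
    have sum': "1/n4 + 1/n2 + 1/n3 + 1/n1 = 2" using sum by (simp add: add_ac)
    have "delta (n4, n2, n3, n1) (a0, a4, a2, a3, a1)
        = n4*n2*n3 * (a0/n3 + a1/n4 + a3/n2 + a4/n1 - a2)"
      unfolding delta_eq[OF nz(4,2,3,1) sum'] by (simp add: add_ac)
    then show ?thesis
      using d[unfolded delta_eq[OF nz sum]] nz sum' by (simp del: delta.simps)
  qed
  {
    case (1 n \<alpha>)
    then show ?case using adm' by (cases n; cases \<alpha>) (simp del: admissible.simps)
  next
    case (2 x y t n \<alpha>)
    then show ?case by (cases n; cases \<alpha>) (simp add: pi3_map_eq del: pi3_map.simps admissible.simps)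
  next
    case (3 v n \<alpha>)
    then show ?case
      by (cases v; cases n; cases \<alpha>)
         (simp add: pi3_map_eq adm' del: pi3_map.simps admissible.simps)
  next
    case 4
    then show ?case by (auto intro: exI[of _ "1::complex"])
  next
    case (7 n \<alpha> U x y X Y)
    obtain n1 n2 n3 n4 where n: "n = (n1, n2, n3, n4)" by (cases n)
    obtain a0 a1 a2 a3 a4 where \<alpha>: "\<alpha> = (a0, a1, a2, a3, a4)" by (cases \<alpha>)
    note adm = 7(1)[unfolded n \<alpha>]
    have sum: "1/n1 + 1/n2 + 1/n3 + 1/n4 = 2" using adm by simp
    have "solves_normal (1/n4) (1/n2) (1/n3) (a0/n3) (a4/n1) (a3/n2) (a1/n4) a2
        ((\<lambda>t. 1/t) ` U) X Y"
      using 7(3,5,6) 7(7)[unfolded n \<alpha> solves_E_iff_normal[OF adm]]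
      by (intro solves_normal_pi3[OF _ _ sum]) (auto simp: n \<alpha> pi3_map_eq[OF adm] simp del: pi3_map.simps)
    then show ?case
      unfolding n \<alpha> using solves_E_iff_normal[OF adm'[OF adm]] by simp
  }
qed (auto simp: pi3_dom_def intro!: continuous_intros)

theorem theorem4p4:
  fixes n1 n2 n3 n4 \<alpha>0 \<alpha>1 \<alpha>2 \<alpha>3 \<alpha>4 :: complex
  assumes "n1 \<noteq> 0" "n2 \<noteq> 0" "n3 \<noteq> 0" "n4 \<noteq> 0"
    and "1/n1 + 1/n2 + 1/n3 + 1/n4 = 2"
    and "delta (n1, n2, n3, n4) (\<alpha>0, \<alpha>1, \<alpha>2, \<alpha>3, \<alpha>4) \<noteq> 0"
  shows
    "E_invariant_under s_dom s_map (n1, n2, n3, n4) (\<alpha>0, \<alpha>1, \<alpha>2, \<alpha>3, \<alpha>4) \<and>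
    E_invariant_under UNIV pi1_map (n1, n2, n3, n4) (\<alpha>0, \<alpha>1, \<alpha>2, \<alpha>3, \<alpha>4) \<and>
    E_invariant_under pi2_dom pi2_map (n1, n2, n3, n4) (\<alpha>0, \<alpha>1, \<alpha>2, \<alpha>3, \<alpha>4) \<and>
    E_invariant_under pi3_dom pi3_map (n1, n2, n3, n4) (\<alpha>0, \<alpha>1, \<alpha>2, \<alpha>3, \<alpha>4)"
  using assms
  by (intro conjI E_invariant_under_s E_invariant_under_pi1 E_invariant_under_pi2
      E_invariant_under_pi3) (simp_all del: delta.simps)

end
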